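(* Let $\eta\in\Omega$. For any $k\in\mathbb N$ and $x\in\mathbb Z_{\ge0}$, $$\lambda_k(x)=\sum_{y=1}^x\eta^\uparrow_k(y),\qquad p_k(x)=x-2\sum_{\ell=1}^k\sum_{y=1}^x\eta^\uparrow_\ell(y),$$ and $$J_k(x)=\left(J_{k,j}(x)=p_k(t_k(x,j))\ ;\ j=1,\dots,m^\uparrow_k(x)\right),$$ where $t_k(x,j):=\max\{1\le y\le x\ ;\ m^\uparrow_k(y)=j,\ \eta^\uparrow_k(y)=1\}$.
   Context: $\mathbb N=\{1,2,\dots\}$ and $\Omega=\{0,1\}^{\mathbb N}$. Seat numbers: for $\eta\in\Omega$ define $\mathcal W_k:\mathbb Z_{\ge0}\to\{0,1\}$, $k\in\mathbb N$, by $\mathcal W_k(0)=0$ and $$\mathcal W_k(x)=\mathcal W_k(x-1)+\eta(x)(1-\mathcal W_k(x-1))\prod_{\ell=1}^{k-1}\mathcal W_\ell(x-1)-(1-\eta(x))\mathcal W_k(x-1)\prod_{\ell=1}^{k-1}(1-\mathcal W_\ell(x-1)).$$ Put $\eta^\uparrow_k(x)=\mathbf 1_{\{\mathcal W_k(x)>\mathcal W_k(x-1)\}}$ for $x\in\mathbb N$, and $m^\uparrow_k(x)=\sum_{y=1}^x(\eta^\uparrow_k(y)-\eta^\uparrow_{k+1}(y))$ for $x\in\mathbb Z_{\ge0}$ (empty sums are $0$). Kerov-Kirillov-Reshetikhin (KKR) construction: from $\eta\in\Omega$ one builds, for $x=0,1,2,\dots$, a partition $\mu(x)=(\mu_1(x)\ge\mu_2(x)\ge\cdots\ge0)$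 together with a rigging $\mathbf J(x)=(J_k(x))_{k\in\mathbb N}$, where $J_k(x)=(J_{k,1}(x)\le\cdots\le J_{k,m_k(x)}(x))$ is a weakly increasing array of integers and $m_k(x)$ is the multiplicity of $k$ in $\mu(x)$ ($J_k(x)=\varnothing$ if $m_k(x)=0$). Let $\lambda_k(x)=|\{i\in\mathbb N\ ;\ \mu_i(x)\ge k\}|$ (conjugate partition), so $m_k(x)=\lambda_k(x)-\lambda_{k+1}(x)$; let $E_k(x)=\sum_{i\in\mathbb N}\min\{\mu_i(x),k\}$ ($k$-th energy) and $p_k(x)=x-2E_k(x)$ ($k$-th vacancy). A row of $\mu(x)$ of length $k\ge1$ is called singular if $p_k(x)=J_{k,m_k(x)}(x)$. Start with $\mu(0)=\varnothing$, $\mathbf J(0)=\varnothing$. Given $(\mu(x),\mathbf J(x))$: - if $\eta(x+1)=0$, set $(\mu(x+1),\mathbf J(x+1))=(\mu(x),\mathbf J(x))$; - if $\eta(x+1)=1$ and there is a singular row, let $k$ be the maximal length of a singular row; replace one row of length $k$ by a row of length $k+1$ to get $\mu(x+1)$, remove the largest entry $J_{k,m_k(x)}(x)$ from $J_k(x)$, and insert the value $p_{k+1}(x+1)$ (computed with $\mu(x+1)$) into $J_{k+1}(x)$, keeping the array weakly increasing; all other arrays are unchanged (so the new row is singular); - if $\eta(x+1)=1$ and there is no singular row, add a row of length $1$ to $\mu(x)$ to get $\mu(x+1)$ and insert $p_1(x+1)$ into $J_1(x)$, keeping the array weakly increasing; other arrays are unchanged. *)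

theory Defs
  imports Complex_Main
begin

text \<open>
  Configurations are functions on nat that take values in {0,1} at the sites 1, 2, \<dots>;
  the value at 0 is never read. All families below are likewise indexed from 1, so that
  their values at index 0 carry no meaning.
\<close>

definition Omega :: "(nat \<Rightarrow> int) set" where
  "Omega = {\<eta>. \<forall>x\<ge>1. \<eta> x \<in> {0, 1}}"


section \<open>Seat numbers\<close>

fun seat :: "(nat \<Rightarrow> int) \<Rightarrow> nat \<Rightarrow> nat \<Rightarrow> int" where
  "seat \<eta> k 0 = 0"
| "seat \<eta> k (Suc x) =
     seat \<eta> k x
     + \<eta> (Suc x) * (1 - seat \<eta> k x) * (\<Prod>l\<in>{1..<k}. seat \<eta> l x)
     - (1 - \<eta> (Suc x)) * seat \<eta> k x * (\<Prod>l\<in>{1..<k}. 1 - seat \<eta> l x)"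

definition eta_up :: "(nat \<Rightarrow> int) \<Rightarrow> nat \<Rightarrow> nat \<Rightarrow> int" where
  "eta_up \<eta> k x = of_bool (seat \<eta> k x > seat \<eta> k (x - 1))"

definition m_up :: "(nat \<Rightarrow> int) \<Rightarrow> nat \<Rightarrow> nat \<Rightarrow> int" where
  "m_up \<eta> k x = (\<Sum>y=1..x. eta_up \<eta> k y - eta_up \<eta> (k + 1) y)"

definition up_times :: "(nat \<Rightarrow> int) \<Rightarrow> nat \<Rightarrow> nat \<Rightarrow> int \<Rightarrow> nat set" where
  "up_times \<eta> k x j = {y. 1 \<le> y \<and> y \<le> x \<and> m_up \<eta> k y = j \<and> eta_up \<eta> k y = 1}"

definition t_up :: "(nat \<Rightarrow> int) \<Rightarrow> nat \<Rightarrow> nat \<Rightarrow> int \<Rightarrow> nat" where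
  "t_up \<eta> k x j = Max (up_times \<eta> k x j)"


section \<open>Rigged partitions\<close>

text \<open>
  A partition is a function \<mu> with \<mu> 1 \<ge> \<mu> 2 \<ge> \<dots> \<ge> 0, only finitely many \<mu> i being nonzero.
\<close>

type_synonym partition = "nat \<Rightarrow> nat"
type_synonym rigging = "nat \<Rightarrow> int list"

definition mult :: "partition \<Rightarrow> nat \<Rightarrow> nat" where
  "mult \<mu> k = card {i. 1 \<le> i \<and> \<mu> i = k}"

definition conj_part :: "partition \<Rightarrow> nat \<Rightarrow> nat" where
  "conj_part \<mu> k = card {i. 1 \<le> i \<and> \<mu> i \<ge> k}"

text \<open>
  The sum is restricted to the nonzero rows because sum over an infinite index set is 0.
\<close>

definition energy :: "partition \<Rightarrow> nat \<Rightarrow> nat" where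
  "energy \<mu> k = (\<Sum>i | 1 \<le> i \<and> \<mu> i \<noteq> 0. min (\<mu> i) k)"

definition vacancy :: "nat \<Rightarrow> partition \<Rightarrow> nat \<Rightarrow> int" where
  "vacancy x \<mu> k = int x - 2 * int (energy \<mu> k)"

text \<open>The entry with index m of an array is at list position m - 1.\<close>

definition singular_length :: "nat \<Rightarrow> partition \<Rightarrow> rigging \<Rightarrow> nat \<Rightarrow> bool" where
  "singular_length x \<mu> J k \<longleftrightarrow>
     1 \<le> k \<and> (\<exists>i\<ge>1. \<mu> i = k) \<and> vacancy x \<mu> k = J k ! (mult \<mu> k - 1)"

text \<open>
  Lengthening the first of the rows of length k keeps the rows weakly decreasing.
  For k = 0 this adds a new row of length 1.
\<close>

definition grow :: "partition \<Rightarrow> nat \<Rightarrow> partition" where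
  "grow \<mu> k = \<mu>((LEAST i. 1 \<le> i \<and> \<mu> i = k) := k + 1)"


section \<open>KKR construction\<close>

text \<open>
  One step from time x to time x + 1, where e is the configuration at x + 1. The arrays
  are sorted, so butlast removes a largest entry.
\<close>

definition kkr_step :: "nat \<Rightarrow> int \<Rightarrow> partition \<times> rigging \<Rightarrow> partition \<times> rigging" where
  "kkr_step x e = (\<lambda>(\<mu>, J).
     if e = 0 then (\<mu>, J)
     else if \<exists>k. singular_length x \<mu> J k then
       (let k = Max {k. singular_length x \<mu> J k}; \<mu>' = grow \<mu> k in
         (\<mu>', J(k := butlast (J k),
                 k + 1 := insort (vacancy (x + 1) \<mu>' (k + 1)) (J (k + 1)))))
     else
       (let \<mu>' = grow \<mu> 0 in
         (\<mu>', J(1 := insort (vacancy (x + 1) \<mu>' 1) (J 1)))))"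

primrec kkr :: "(nat \<Rightarrow> int) \<Rightarrow> nat \<Rightarrow> partition \<times> rigging" where
  "kkr \<eta> 0 = ((\<lambda>_. 0), (\<lambda>_. []))"
| "kkr \<eta> (Suc x) = kkr_step x (\<eta> (Suc x)) (kkr \<eta> x)"

definition kkr_mu :: "(nat \<Rightarrow> int) \<Rightarrow> nat \<Rightarrow> partition" where
  "kkr_mu \<eta> x = fst (kkr \<eta> x)"

definition kkr_J :: "(nat \<Rightarrow> int) \<Rightarrow> nat \<Rightarrow> nat \<Rightarrow> int list" where
  "kkr_J \<eta> k x = snd (kkr \<eta> x) k"

definition kkr_lambda :: "(nat \<Rightarrow> int) \<Rightarrow> nat \<Rightarrow> nat \<Rightarrow> nat" where
  "kkr_lambda \<eta> k x = conj_part (kkr_mu \<eta> x) k"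

definition kkr_p :: "(nat \<Rightarrow> int) \<Rightarrow> nat \<Rightarrow> nat \<Rightarrow> int" where
  "kkr_p \<eta> k x = vacancy x (kkr_mu \<eta> x) k"

end

theory Submission
  imports Defs
begin

text \<open>
  A site with $\eta = 1$ fills the first empty seat and a site with $\eta = 0$ empties the first
  occupied one. Filling seat \<open>s\<close> pushes the current vacancy $p_s$ onto the array
  of \<open>s\<close> and pops the array of \<open>s - 1\<close>. The charge
  $q_k = p_k + \sum_{l \le k} W_l$ never decreases, and it is constant as long as seat \<open>k\<close>
  is occupied and seat \<open>k + 1\<close> is empty. All entries of the array of \<open>k\<close> are at most
  $q_k - k$, so a singular row of length \<open>k\<close> forces $p_k \le q_k - k$, that is,
  the seats $1, \dots, k$ are all occupied. Conversely, if \<open>s > 1\<close> is the first empty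
  seat, the last entry of the array of \<open>s - 1\<close> equals $q_{s-1} - (s - 1) = p_{s-1}$. Hence the
  maximal singular length is \<open>s - 1\<close>, and the KKR step adds a box to column \<open>s\<close>.
\<close>

section \<open>Dynamics of the seats\<close>

text \<open>\<open>ups\<close>, \<open>vac\<close> and \<open>rig\<close> are the values claimed for
  \<open>kkr_lambda\<close>, \<open>kkr_p\<close> and \<open>kkr_J\<close>. Expressed through the
  seats alone, they can be studied before the KKR state enters.\<close>

definition ups :: "(nat \<Rightarrow> int) \<Rightarrow> nat \<Rightarrow> nat \<Rightarrow> int" where
  "ups \<eta> k x = (\<Sum>y=1..x. eta_up \<eta> k y)"

definition vac :: "(nat \<Rightarrow> int) \<Rightarrow> nat \<Rightarrow> nat \<Rightarrow> int" where
  "vac \<eta> k x = int x - 2 * (\<Sum>l=1..k. ups \<eta> l x)"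

definition charge :: "(nat \<Rightarrow> int) \<Rightarrow> nat \<Rightarrow> nat \<Rightarrow> int" where
  "charge \<eta> k x = vac \<eta> k x + (\<Sum>l=1..k. seat \<eta> l x)"

definition rig :: "(nat \<Rightarrow> int) \<Rightarrow> nat \<Rightarrow> nat \<Rightarrow> int list" where
  "rig \<eta> k x = map (\<lambda>j. vac \<eta> k (t_up \<eta> k x j)) [1..m_up \<eta> k x]"

text \<open>Collects all effects of a site with value 1. Once \<open>seat_fill\<close> is proved,
  the proofs treat such a site through this predicate instead of the recursion.\<close>

definition fills :: "(nat \<Rightarrow> int) \<Rightarrow> nat \<Rightarrow> nat \<Rightarrow> bool" where
  "fills \<eta> x s \<longleftrightarrow> 1 \<le> s \<and> seat \<eta> s x = 0 \<and> (\<forall>l. 1 \<le> l \<and> l < s \<longrightarrow> seat \<eta> l x = 1)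
    \<and> (\<forall>l\<ge>1. seat \<eta> l (Suc x) = (if l = s then 1 else seat \<eta> l x))
    \<and> (\<forall>l\<ge>1. eta_up \<eta> l (Suc x) = of_bool (l = s))"

lemma fillsD:
  assumes "fills \<eta> x s"
  shows "1 \<le> s" "seat \<eta> s x = 0" "\<And>l. 1 \<le> l \<Longrightarrow> l < s \<Longrightarrow> seat \<eta> l x = 1"
    "\<And>l. 1 \<le> l \<Longrightarrow> seat \<eta> l (Suc x) = (if l = s then 1 else seat \<eta> l x)"
    "\<And>l. 1 \<le> l \<Longrightarrow> eta_up \<eta> l (Suc x) = of_bool (l = s)"
  using assms unfolding fills_def by blast+

declare seat.simps(2) [simp del]

lemma ups_Suc: "ups \<eta> k (Suc x) = ups \<eta> k x + eta_up \<eta> k (Suc x)"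
  by (simp add: ups_def)

lemma m_up_eq: "m_up \<eta> k x = ups \<eta> k x - ups \<eta> (k + 1) x"
  by (simp add: m_up_def ups_def sum_subtractf)

lemma prod_zero_one:
  fixes f :: "'a \<Rightarrow> int"
  assumes "finite A" "\<And>a. a \<in> A \<Longrightarrow> f a \<in> {0, 1}"
  shows "prod f A = of_bool (\<forall>a\<in>A. f a = 1)"
proof (cases "\<forall>a\<in>A. f a = 1")
  case False
  then obtain a where "a \<in> A" "f a = 0" using assms(2) by blast
  then have "prod f A = 0" using assms(1) by (meson prod_zero)
  with False show ?thesis by simp
qed simp

lemma seat_zero_one:
  assumes "\<eta> \<in> Omega"
  shows "seat \<eta> k x \<in> {0, 1}"
proof (induction x arbitrary: k)
  case (Suc x)
  have *: "(\<Prod>l\<in>{1..<k}. seat \<eta> l x) \<in> {0, 1}" "(\<Prod>l\<in>{1..<k}. 1 - seat \<eta> l x) \<in> {0, 1}"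
    using Suc by (subst prod_zero_one; force)+
  have "\<eta> (Suc x) \<in> {0, 1}" using assms by (auto simp: Omega_def)
  moreover have "seat \<eta> k x \<in> {0, 1}" by (rule Suc)
  moreover have "a + e * (1 - a) * P - (1 - e) * a * Q \<in> {0, 1}"
    if "a \<in> {0, 1}" "e \<in> {0, 1}" "P \<in> {0, 1}" "Q \<in> {0, 1}" for a e P Q :: int
    using that by auto
  ultimately show ?case using * by (simp add: seat.simps(2))
qed simp

text \<open>Seat \<open>Suc x\<close> is still empty at time \<open>x\<close>, so no seat behind it
  can be filled in the next step. Hence an empty seat always exists, as \<open>seat_fill\<close>
  requires.\<close>

lemma seat_beyond: "x < k \<Longrightarrow> seat \<eta> k x = 0"
proof (induction x arbitrary: k)
  case (Suc x)
  have "seat \<eta> (Suc x) x = 0" "Suc x \<in> {1..<k}" using Suc by auto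
  then have "(\<Prod>l\<in>{1..<k}. seat \<eta> l x) = 0" by (meson finite_atLeastLessThan prod_zero)
  with Suc show ?case by (simp add: seat.simps(2))
qed simp

context
  fixes \<eta> :: "nat \<Rightarrow> int"
  assumes config: "\<eta> \<in> Omega"
begin

text \<open>If all lower seats are occupied, an empty seat \<open>k\<close> gets filled and an
  occupied one stays so; the new value is 1 either way.\<close>

lemma seat_Suc_one:
  assumes "\<eta> (Suc x) = 1"
  shows "seat \<eta> k (Suc x) = (if \<forall>l\<in>{1..<k}. seat \<eta> l x = 1 then 1 else seat \<eta> k x)"
  using seat_zero_one[OF config] assms by (simp add: seat.simps(2) prod_zero_one)

lemma seat_Suc_zero:
  assumes "\<eta> (Suc x) = 0"
  shows "seat \<eta> k (Suc x) = (if \<forall>l\<in>{1..<k}. seat \<eta> l x = 0 then 0 else seat \<eta> k x)"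
proof -
  have "(\<Prod>l\<in>{1..<k}. 1 - seat \<eta> l x) = of_bool (\<forall>l\<in>{1..<k}. 1 - seat \<eta> l x = 1)"
    using seat_zero_one[OF config, of _ x] by (intro prod_zero_one) force+
  with assms show ?thesis by (simp add: seat.simps(2))
qed

lemma seat_fill:
  assumes "\<eta> (Suc x) = 1"
  shows "\<exists>s. fills \<eta> x s"
proof -
  define s where "s = (LEAST s. 1 \<le> s \<and> seat \<eta> s x = 0)"
  have "1 \<le> Suc x \<and> seat \<eta> (Suc x) x = 0" by (simp add: seat_beyond)
  then have s: "1 \<le> s" "seat \<eta> s x = 0"
    unfolding s_def by (metis (mono_tags, lifting) LeastI)+
  have below: "seat \<eta> l x = 1" if "1 \<le> l" "l < s" for l
    using not_less_Least[of l "\<lambda>s. 1 \<le> s \<and> seat \<eta> s x = 0"] that seat_zero_one[OF config, of l x]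
    by (auto simp: s_def)
  have step: "seat \<eta> l (Suc x) = (if l = s then 1 else seat \<eta> l x)" if "1 \<le> l" for l
  proof (cases l s rule: linorder_cases)
    \<comment> \<open>The empty seat \<open>s\<close> lies below \<open>l\<close> and blocks
      it.\<close>
    case greater
    with s have "\<not> (\<forall>l\<in>{1..<l}. seat \<eta> l x = 1)" by force
    with greater show ?thesis by (simp only: seat_Suc_one[OF assms] if_False) simp
  qed (use that below in \<open>auto simp: seat_Suc_one[OF assms]\<close>)
  have "eta_up \<eta> l (Suc x) = of_bool (l = s)" if "1 \<le> l" for l
    using step[OF that] s by (auto simp: eta_up_def)
  with s below step show ?thesis unfolding fills_def by blast
qed

lemma eta_up_zero:
  assumes "\<eta> (Suc x) = 0"
  shows "eta_up \<eta> k (Suc x) = 0"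
  using seat_zero_one[OF config, of k x]
  by (auto simp: eta_up_def seat_Suc_zero[OF assms])

section \<open>Monotonicity of the charge\<close>

text \<open>Time contributes 1. If \<open>s \<le> k\<close>, the new up-step contributes -2 and the
  newly occupied seat 1, so the total change is 0.\<close>

lemma charge_Suc_fill:
  assumes "fills \<eta> x s"
  shows "charge \<eta> k (Suc x) = charge \<eta> k x + of_bool (k < s)"
proof -
  note s = fillsD[OF assms]
  have "(\<Sum>l=1..k. ups \<eta> l (Suc x)) = (\<Sum>l=1..k. ups \<eta> l x + of_bool (l = s))"
    by (intro sum.cong) (auto simp: ups_Suc s)
  moreover have "(\<Sum>l=1..k. seat \<eta> l (Suc x)) = (\<Sum>l=1..k. seat \<eta> l x + of_bool (l = s))"
    by (intro sum.cong) (use s in auto)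
  moreover have "(\<Sum>l=1..k. of_bool (l = s)) = (of_bool (s \<le> k) :: int)"
    using s(1) by (simp add: of_bool_def sum.delta)
  ultimately show ?thesis by (auto simp: charge_def vac_def sum.distrib)
qed

text \<open>No seat is filled, so the vacancy grows by 1. Emptying the first occupied seat takes
  this 1 back exactly when that seat is among the first \<open>k\<close>.\<close>

lemma charge_Suc_empty:
  assumes "\<eta> (Suc x) = 0"
  shows "charge \<eta> k (Suc x) = charge \<eta> k x + of_bool (\<forall>l\<in>{1..k}. seat \<eta> l x = 0)"
proof -
  have u: "(\<Sum>l=1..k. ups \<eta> l (Suc x)) = (\<Sum>l=1..k. ups \<eta> l x)"
    by (simp add: ups_Suc eta_up_zero[OF assms])
  have "(\<Sum>l=1..k. seat \<eta> l (Suc x))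
      = (\<Sum>l=1..k. seat \<eta> l x) - of_bool (\<not> (\<forall>l\<in>{1..k}. seat \<eta> l x = 0))"
  proof (induction k)
    case (Suc k)
    then show ?case
      using seat_zero_one[OF config, of "Suc k" x]
      by (auto simp: seat_Suc_zero[OF assms] atLeastLessThanSuc_atLeastAtMost le_Suc_eq)
  qed simp
  with u show ?thesis by (auto simp: charge_def vac_def)
qed

lemma charge_mono: "charge \<eta> k x \<le> charge \<eta> k (Suc x)"
proof -
  consider "\<eta> (Suc x) = 1" | "\<eta> (Suc x) = 0" using config by (auto simp: Omega_def)
  then show ?thesis
  proof cases
    case 1
    then obtain s where "fills \<eta> x s" using seat_fill by blast
    then show ?thesis by (simp add: charge_Suc_fill)
  qed (simp add: charge_Suc_empty)
qed

text \<open>The difference \<open>vac \<eta> k x - (charge \<eta> k x - int k)\<close> is the number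
  of empty seats among the first \<open>k\<close>.\<close>

lemma vac_le_charge_iff_full:
  "vac \<eta> k x \<le> charge \<eta> k x - int k \<longleftrightarrow> (\<forall>l\<in>{1..k}. seat \<eta> l x = 1)"
proof -
  have le: "seat \<eta> l x \<le> 1" for l using seat_zero_one[OF config, of l x] by auto
  have "0 \<le> (\<Sum>l=1..k. 1 - seat \<eta> l x)" using le by (intro sum_nonneg) simp
  moreover have "(\<Sum>l=1..k. 1 - seat \<eta> l x) = 0 \<longleftrightarrow> (\<forall>l\<in>{1..k}. 1 - seat \<eta> l x = 0)"
    using le by (intro sum_nonneg_eq_0_iff) auto
  moreover have "(\<Sum>l=1..k. 1 - seat \<eta> l x) = int k - (\<Sum>l=1..k. seat \<eta> l x)"
    by (simp add: sum_subtractf)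
  ultimately show ?thesis by (auto simp: charge_def)
qed

lemma vac_eq_charge_if_full:
  assumes "\<And>l. 1 \<le> l \<Longrightarrow> l \<le> k \<Longrightarrow> seat \<eta> l x = 1"
  shows "vac \<eta> k x = charge \<eta> k x - int k"
  using assms by (simp add: charge_def)

section \<open>The arrays as stacks\<close>

text \<open>Nonnegativity alone is not inductive: filling seat \<open>k + 1\<close> lowers
  \<open>m_up\<close> by 1. This happens only while seat \<open>k\<close> is occupied and seat
  \<open>k + 1\<close> is empty, and then the stronger bound supplies an entry to remove.\<close>

lemma m_up_ge: "1 \<le> k \<Longrightarrow> seat \<eta> k x * (1 - seat \<eta> (k + 1) x) \<le> m_up \<eta> k x"
proof (induction x)
  case (Suc x)
  note zo = seat_zero_one[OF config, of k x] seat_zero_one[OF config, of "k + 1" x]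
  consider "\<eta> (Suc x) = 1" | "\<eta> (Suc x) = 0" using config by (auto simp: Omega_def)
  then show ?case
  proof cases
    case 1
    then obtain s where "fills \<eta> x s" using seat_fill by blast
    note s = fillsD[OF this]
    have "m_up \<eta> k (Suc x) = m_up \<eta> k x + of_bool (k = s) - of_bool (k + 1 = s)"
      using Suc.prems by (simp add: m_up_eq ups_Suc s(5))
    moreover have "seat \<eta> k (Suc x) = (if k = s then 1 else seat \<eta> k x)"
      "seat \<eta> (k + 1) (Suc x) = (if k + 1 = s then 1 else seat \<eta> (k + 1) x)"
      using Suc.prems by (auto simp: s(4))
    moreover have "seat \<eta> (k + 1) x = 0 \<and> seat \<eta> k x = 1" if "k + 1 = s"
      using that s(2) s(3)[of k] Suc.prems by auto
    moreover have "seat \<eta> k x * (1 - seat \<eta> (k + 1) x) \<le> m_up \<eta> k x" using Suc by blast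
    ultimately show ?thesis
      using zo by (cases "k = s"; cases "k + 1 = s") auto
  next
    case 2
    then have "m_up \<eta> k (Suc x) = m_up \<eta> k x"
      by (simp add: m_up_eq ups_Suc eta_up_zero)
    moreover have "seat \<eta> k (Suc x) \<in> {0, seat \<eta> k x}"
      by (simp add: seat_Suc_zero[OF 2])
    \<comment> \<open>An occupied seat \<open>k\<close> protects seat \<open>k + 1\<close> from
      being emptied.\<close>
    moreover have "seat \<eta> (k + 1) (Suc x) = seat \<eta> (k + 1) x" if "seat \<eta> k x = 1"
    proof -
      have "\<not> (\<forall>l\<in>{1..<k+1}. seat \<eta> l x = 0)" using that Suc.prems by force
      then show ?thesis by (simp only: seat_Suc_zero[OF 2] if_False)
    qed
    moreover have "seat \<eta> k x * (1 - seat \<eta> (k + 1) x) \<le> m_up \<eta> k x" using Suc by blast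
    ultimately show ?thesis using zo by auto
  qed
qed (simp add: m_up_def)

lemma m_up_nonneg: "1 \<le> k \<Longrightarrow> 0 \<le> m_up \<eta> k x"
  using m_up_ge[of k x] seat_zero_one[OF config, of k x] seat_zero_one[OF config, of "k + 1" x]
  by auto

lemma length_rig: "length (rig \<eta> k x) = nat (m_up \<eta> k x)"
  by (simp add: rig_def)

text \<open>The set \<open>up_times\<close> gains a time only when a push reaches level
  \<open>j\<close>. A level may be reached repeatedly, after pops; the maximum in
  \<open>t_up\<close> keeps its latest push, which is the entry currently on the stack.\<close>

lemma t_up_Suc_old:
  assumes "eta_up \<eta> k (Suc x) = 0 \<or> m_up \<eta> k (Suc x) \<noteq> j"
  shows "t_up \<eta> k (Suc x) j = t_up \<eta> k x j"
proof -
  have "up_times \<eta> k (Suc x) j = up_times \<eta> k x j"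
    using assms by (auto simp: up_times_def le_Suc_eq)
  then show ?thesis by (simp add: t_up_def)
qed

lemma t_up_Suc_new:
  assumes "eta_up \<eta> k (Suc x) = 1"
  shows "t_up \<eta> k (Suc x) (m_up \<eta> k (Suc x)) = Suc x"
  unfolding t_up_def
proof (rule Max_eqI)
  have "up_times \<eta> k (Suc x) (m_up \<eta> k (Suc x)) \<subseteq> {..Suc x}" by (auto simp: up_times_def)
  then show "finite (up_times \<eta> k (Suc x) (m_up \<eta> k (Suc x)))" by (rule finite_subset) simp
qed (use assms in \<open>auto simp: up_times_def\<close>)

lemma rig_push:
  assumes "1 \<le> k" "eta_up \<eta> k (Suc x) = 1" "eta_up \<eta> (k + 1) (Suc x) = 0"
  shows "rig \<eta> k (Suc x) = rig \<eta> k x @ [vac \<eta> k (Suc x)]"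
proof -
  have m: "m_up \<eta> k (Suc x) = m_up \<eta> k x + 1" using assms by (simp add: m_up_eq ups_Suc)
  have "t_up \<eta> k (Suc x) (m_up \<eta> k x + 1) = Suc x" using t_up_Suc_new[OF assms(2)] m by simp
  moreover have "[1..m_up \<eta> k x + 1] = [1..m_up \<eta> k x] @ [m_up \<eta> k x + 1]"
    using m_up_nonneg[OF assms(1), of x] by (subst upto_rec2) auto
  moreover have "t_up \<eta> k (Suc x) j = t_up \<eta> k x j" if "j \<in> {1..m_up \<eta> k x}" for j
    using that m by (intro t_up_Suc_old) auto
  ultimately show ?thesis by (simp add: rig_def m)
qed

lemma rig_pop:
  assumes "1 \<le> k" "eta_up \<eta> k (Suc x) = 0" "eta_up \<eta> (k + 1) (Suc x) = 1"
  shows "rig \<eta> k (Suc x) = butlast (rig \<eta> k x)"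
proof -
  have m: "m_up \<eta> k (Suc x) = m_up \<eta> k x - 1" using assms by (simp add: m_up_eq ups_Suc)
  \<comment> \<open>Nonnegativity after the pop shows that the array was nonempty before it.\<close>
  then have "[1..m_up \<eta> k x] = [1..m_up \<eta> k x - 1] @ [m_up \<eta> k x]"
    using m_up_nonneg[OF assms(1), of "Suc x"] by (subst upto_rec2) auto
  then show ?thesis by (simp add: rig_def m t_up_Suc_old assms)
qed

lemma rig_idle:
  assumes "eta_up \<eta> k (Suc x) = 0" "eta_up \<eta> (k + 1) (Suc x) = 0"
  shows "rig \<eta> k (Suc x) = rig \<eta> k x"
  using assms by (simp add: rig_def m_up_eq ups_Suc t_up_Suc_old)

text \<open>\<open>m_up\<close> rises by at most 1 per step, and only by an up-step of seat
  \<open>k\<close>, so every level up to the current one was reached by a push. Thus the maximum in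
  \<open>t_up\<close> is never taken over the empty set.\<close>

lemma up_times_nonempty:
  "1 \<le> k \<Longrightarrow> j \<in> {1..m_up \<eta> k x} \<Longrightarrow> up_times \<eta> k x j \<noteq> {}"
proof (induction x)
  case (Suc x)
  show ?case
  proof (cases "j \<le> m_up \<eta> k x")
    case True
    then have "up_times \<eta> k x j \<noteq> {}" using Suc by simp
    then show ?thesis by (auto simp: up_times_def intro: le_SucI)
  next
    case False
    have "eta_up \<eta> k (Suc x) \<in> {0, 1}" "eta_up \<eta> (k + 1) (Suc x) \<in> {0, 1}"
      by (simp_all add: eta_up_def)
    with False Suc.prems have "eta_up \<eta> k (Suc x) = 1" "m_up \<eta> k (Suc x) = j"
      by (auto simp: m_up_eq ups_Suc)
    then have "Suc x \<in> up_times \<eta> k (Suc x) j" by (simp add: up_times_def)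
    then show ?thesis by blast
  qed
qed (simp add: m_up_def)

text \<open>A push leaves the seats \<open>1..k\<close> full, so the pushed value is the current
  charge minus \<open>k\<close>. As the charge never decreases, this value bounds all older entries,
  which gives sortedness. A pop fills seat \<open>k + 1\<close> and makes the last clause
  vacuous.\<close>

lemma rig_invariant:
  "1 \<le> k \<Longrightarrow> sorted (rig \<eta> k x) \<and> (\<forall>e\<in>set (rig \<eta> k x). e \<le> charge \<eta> k x - int k)
    \<and> (seat \<eta> k x = 1 \<and> seat \<eta> (k + 1) x = 0 \<longrightarrow> last (rig \<eta> k x) = charge \<eta> k x - int k)"
proof (induction x)
  case 0
  then show ?case by (simp add: rig_def m_up_def)
next
  case (Suc x)
  note mono = charge_mono[of k x]
  consider "\<eta> (Suc x) = 1" | "\<eta> (Suc x) = 0" using config by (auto simp: Omega_def)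
  then show ?case
  proof cases
    case 1
    then obtain s where "fills \<eta> x s" using seat_fill by blast
    note ch = charge_Suc_fill[OF this, of k] and s = fillsD[OF this]
    consider "k = s" | "k + 1 = s" | "k \<noteq> s" "k + 1 \<noteq> s" by blast
    then show ?thesis
    proof cases
      case 1
      have "rig \<eta> k (Suc x) = rig \<eta> k x @ [vac \<eta> k (Suc x)]"
        using Suc.prems 1 by (intro rig_push) (auto simp: s)
      moreover have "vac \<eta> k (Suc x) = charge \<eta> k (Suc x) - int k"
        using 1 s by (intro vac_eq_charge_if_full) auto
      ultimately show ?thesis using Suc mono by (force simp: sorted_append)
    next
      case 2
      have "rig \<eta> k (Suc x) = butlast (rig \<eta> k x)"
        using Suc.prems 2 by (intro rig_pop) (auto simp: s)
      moreover have "seat \<eta> (k + 1) (Suc x) = 1" using 2 s by simp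
      ultimately show ?thesis
        using Suc mono by (force simp: sorted_butlast dest: in_set_butlastD)
    next
      case 3
      have "rig \<eta> k (Suc x) = rig \<eta> k x"
        using Suc.prems 3 by (intro rig_idle) (auto simp: s)
      moreover have "seat \<eta> k (Suc x) = seat \<eta> k x" "seat \<eta> (k + 1) (Suc x) = seat \<eta> (k + 1) x"
        using 3 Suc.prems s(4)[of k] s(4)[of "k + 1"] by simp_all
      \<comment> \<open>All seats below \<open>s\<close> are occupied, so an empty seat
        \<open>k + 1\<close> different from \<open>s\<close> forces \<open>s < k + 1\<close>. The
        filled seat then counts in the charge of \<open>k\<close>.\<close>
      moreover have "charge \<eta> k (Suc x) = charge \<eta> k x" if "seat \<eta> (k + 1) x = 0"
        using ch 3 s(3)[of "k + 1"] that by (cases "k < s") auto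
      ultimately show ?thesis using Suc mono by force
    qed
  next
    case 2
    have "rig \<eta> k (Suc x) = rig \<eta> k x"
      by (intro rig_idle eta_up_zero 2)
    moreover have "seat \<eta> k x = 1 \<and> seat \<eta> (k + 1) x = 0 \<and> charge \<eta> k (Suc x) = charge \<eta> k x"
      if "seat \<eta> k (Suc x) = 1" "seat \<eta> (k + 1) (Suc x) = 0"
    proof -
      have k: "seat \<eta> k x = 1" using that(1) by (simp add: seat_Suc_zero[OF 2] split: if_splits)
      with Suc.prems have ne: "\<not> (\<forall>l\<in>{1..<k+1}. seat \<eta> l x = 0)" "\<not> (\<forall>l\<in>{1..k}. seat \<eta> l x = 0)"
        by force+
      from that(2) ne(1) have "seat \<eta> (k + 1) x = 0"
        by (simp only: seat_Suc_zero[OF 2] if_False)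
      with k ne(2) charge_Suc_empty[OF 2, of k] show ?thesis by auto
    qed
    ultimately show ?thesis using Suc mono by force
  qed
qed

end

section \<open>Partitions\<close>

lemma finite_rows_ge:
  fixes \<mu> :: partition
  assumes "finite {i. 1 \<le> i \<and> \<mu> i \<noteq> 0}" "1 \<le> k"
  shows "finite {i. 1 \<le> i \<and> k \<le> \<mu> i}"
  by (rule finite_subset[OF _ assms(1)]) (use assms(2) in auto)

lemma mult_eq_conj_part:
  assumes "finite {i. 1 \<le> i \<and> \<mu> i \<noteq> 0}" "1 \<le> k"
  shows "int (mult \<mu> k) = int (conj_part \<mu> k) - int (conj_part \<mu> (k + 1))"
proof -
  have "conj_part \<mu> k = card ({i. 1 \<le> i \<and> \<mu> i = k} \<union> {i. 1 \<le> i \<and> k + 1 \<le> \<mu> i})"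
    unfolding conj_part_def by (rule arg_cong[where f = card]) auto
  also have "\<dots> = mult \<mu> k + conj_part \<mu> (k + 1)"
    unfolding mult_def conj_part_def
  proof (rule card_Un_disjoint)
    show "finite {i. 1 \<le> i \<and> \<mu> i = k}"
      by (rule finite_subset[OF _ finite_rows_ge[OF assms]]) auto
  qed (use finite_rows_ge[OF assms(1)] in auto)
  finally show ?thesis by simp
qed

lemma mult_pos_iff:
  assumes "finite {i. 1 \<le> i \<and> \<mu> i \<noteq> 0}" "1 \<le> k"
  shows "0 < mult \<mu> k \<longleftrightarrow> (\<exists>i\<ge>1. \<mu> i = k)"
proof -
  have "finite {i. 1 \<le> i \<and> \<mu> i = k}"
    by (rule finite_subset[OF _ finite_rows_ge[OF assms]]) auto
  then show ?thesis by (auto simp: mult_def card_gt_0_iff)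
qed

text \<open>Both sides count the boxes in the first \<open>k\<close> columns, once by rows and once
  by columns.\<close>

lemma energy_eq_conj_part:
  assumes "finite {i. 1 \<le> i \<and> \<mu> i \<noteq> 0}"
  shows "energy \<mu> k = (\<Sum>l=1..k. conj_part \<mu> l)"
proof -
  let ?R = "{i. 1 \<le> i \<and> \<mu> i \<noteq> 0}"
  have "min (\<mu> i) k = (\<Sum>l=1..k. of_bool (l \<le> \<mu> i))" for i
    by (induction k) auto
  then have "energy \<mu> k = (\<Sum>l=1..k. \<Sum>i\<in>?R. of_bool (l \<le> \<mu> i))"
    unfolding energy_def by (simp only: sum.swap[of _ _ "{1..k}"])
  also have "\<dots> = (\<Sum>l=1..k. conj_part \<mu> l)"
  proof (intro sum.cong refl)
    fix l assume "l \<in> {1..k}"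
    then have "?R \<inter> {i. l \<le> \<mu> i} = {i. 1 \<le> i \<and> l \<le> \<mu> i}" by auto
    then show "(\<Sum>i\<in>?R. of_bool (l \<le> \<mu> i)) = conj_part \<mu> l"
      using assms by (simp add: conj_part_def sum_of_bool_eq)
  qed
  finally show ?thesis .
qed

lemma grow_row:
  assumes "\<exists>i\<ge>1. \<mu> i = k"
  obtains r where "1 \<le> r" "\<mu> r = k" "grow \<mu> k = \<mu>(r := k + 1)"
proof -
  have "1 \<le> (LEAST i. 1 \<le> i \<and> \<mu> i = k) \<and> \<mu> (LEAST i. 1 \<le> i \<and> \<mu> i = k) = k"
    using assms by (metis (mono_tags, lifting) LeastI)
  then show thesis using that unfolding grow_def by blast
qed

lemma finite_grow:
  assumes "finite {i. 1 \<le> i \<and> \<mu> i \<noteq> 0}" "\<exists>i\<ge>1. \<mu> i = k"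
  shows "finite {i. 1 \<le> i \<and> grow \<mu> k i \<noteq> 0}"
proof -
  obtain r where "grow \<mu> k = \<mu>(r := k + 1)" using grow_row[OF assms(2)] .
  then have "{i. 1 \<le> i \<and> grow \<mu> k i \<noteq> 0} \<subseteq> insert r {i. 1 \<le> i \<and> \<mu> i \<noteq> 0}" by auto
  then show ?thesis by (rule finite_subset) (use assms in blast)
qed

text \<open>The added box lies in column \<open>k + 1\<close>. The case \<open>k = 0\<close> is
  included and describes a new row of length 1.\<close>

lemma conj_part_grow:
  assumes "finite {i. 1 \<le> i \<and> \<mu> i \<noteq> 0}" "\<exists>i\<ge>1. \<mu> i = k" "1 \<le> l"
  shows "conj_part (grow \<mu> k) l = conj_part \<mu> l + of_bool (l = k + 1)"
proof -
  obtain r where r: "1 \<le> r" "\<mu> r = k" "grow \<mu> k = \<mu>(r := k + 1)" using grow_row[OF assms(2)] .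
  show ?thesis
  proof (cases "l = k + 1")
    case True
    have "{i. 1 \<le> i \<and> l \<le> grow \<mu> k i} = insert r {i. 1 \<le> i \<and> l \<le> \<mu> i}"
      using r True by auto
    with True r finite_rows_ge[OF assms(1,3)] show ?thesis by (simp add: conj_part_def)
  next
    case False
    with r have "{i. 1 \<le> i \<and> l \<le> grow \<mu> k i} = {i. 1 \<le> i \<and> l \<le> \<mu> i}" by auto
    with False show ?thesis by (simp add: conj_part_def)
  qed
qed

section \<open>The KKR state\<close>

text \<open>The invariant linking the KKR state to the seats. Finiteness is carried along because
  \<open>card\<close> and \<open>sum\<close> default to 0 on infinite sets.\<close>

definition matches :: "(nat \<Rightarrow> int) \<Rightarrow> nat \<Rightarrow> partition \<times> rigging \<Rightarrow> bool" where
  "matches \<eta> x st \<longleftrightarrow> finite {i. 1 \<le> i \<and> fst st i \<noteq> 0}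
     \<and> (\<forall>k\<ge>1. int (conj_part (fst st) k) = ups \<eta> k x \<and> snd st k = rig \<eta> k x)"

text \<open>Speaks of the partition only: the KKR step inserts a vacancy of the grown partition, so
  this value must be known before the new arrays are.\<close>

lemma matches_vacancy:
  assumes "finite {i. 1 \<le> i \<and> \<mu> i \<noteq> 0}" "\<And>k. 1 \<le> k \<Longrightarrow> int (conj_part \<mu> k) = ups \<eta> k x"
  shows "vacancy x \<mu> k = vac \<eta> k x"
proof -
  have "(\<Sum>l=1..k. int (conj_part \<mu> l)) = (\<Sum>l=1..k. ups \<eta> l x)"
    by (intro sum.cong) (auto simp: assms(2))
  then show ?thesis by (simp add: vacancy_def vac_def energy_eq_conj_part[OF assms(1)])
qed

lemma matches_mult:
  assumes "matches \<eta> x (\<mu>, J)" "1 \<le> k"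
  shows "int (mult \<mu> k) = m_up \<eta> k x"
  using assms by (simp add: matches_def mult_eq_conj_part m_up_eq)

lemma singular_iff:
  assumes "\<eta> \<in> Omega" "matches \<eta> x (\<mu>, J)" "1 \<le> k"
  shows "singular_length x \<mu> J k \<longleftrightarrow> 0 < m_up \<eta> k x \<and> vac \<eta> k x = last (rig \<eta> k x)"
proof -
  have fin: "finite {i. 1 \<le> i \<and> \<mu> i \<noteq> 0}" and J: "J k = rig \<eta> k x"
    using assms by (auto simp: matches_def)
  have vac: "vacancy x \<mu> k = vac \<eta> k x"
    using assms(2) by (intro matches_vacancy) (auto simp: matches_def)
  \<comment> \<open>Thus the index \<open>mult \<mu> k - 1\<close> in \<open>singular_length\<close>
    is the last position whenever the array is nonempty.\<close>
  have len: "length (rig \<eta> k x) = mult \<mu> k"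
    using matches_mult[OF assms(2,3)] by (simp add: length_rig[OF assms(1)])
  have row: "(\<exists>i\<ge>1. \<mu> i = k) \<longleftrightarrow> 0 < m_up \<eta> k x"
    unfolding mult_pos_iff[OF fin assms(3), symmetric] matches_mult[OF assms(2,3), symmetric]
    by simp
  have "J k ! (mult \<mu> k - 1) = last (rig \<eta> k x)" if "0 < m_up \<eta> k x"
  proof -
    have "rig \<eta> k x \<noteq> []" using that len matches_mult[OF assms(2,3)] by auto
    then show ?thesis by (simp add: J last_conv_nth len)
  qed
  with row assms(3) show ?thesis by (auto simp: singular_length_def vac)
qed

lemma matches_step:
  assumes config: "\<eta> \<in> Omega" and m: "matches \<eta> x (\<mu>, J)"
  shows "matches \<eta> (Suc x) (kkr_step x (\<eta> (Suc x)) (\<mu>, J))"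
proof -
  have fin: "finite {i. 1 \<le> i \<and> \<mu> i \<noteq> 0}"
    and conj: "\<And>k. 1 \<le> k \<Longrightarrow> int (conj_part \<mu> k) = ups \<eta> k x"
    and J: "\<And>k. 1 \<le> k \<Longrightarrow> J k = rig \<eta> k x"
    using m by (auto simp: matches_def)
  consider "\<eta> (Suc x) = 1" | "\<eta> (Suc x) = 0" using config by (auto simp: Omega_def)
  then show ?thesis
  proof cases
    case 2
    then have "ups \<eta> k (Suc x) = ups \<eta> k x" "rig \<eta> k (Suc x) = rig \<eta> k x" for k
      by (simp_all add: ups_Suc rig_idle[OF config] eta_up_zero[OF config])
    with 2 m show ?thesis by (simp add: kkr_step_def matches_def)
  next
    case 1
    then obtain s where "fills \<eta> x s" using seat_fill[OF config] by blast
    note s = fillsD[OF this]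
    have below: "k < s" if "singular_length x \<mu> J k" for k
    proof -
      have k: "1 \<le> k" using that by (simp add: singular_length_def)
      have sing: "0 < m_up \<eta> k x" "vac \<eta> k x = last (rig \<eta> k x)"
        using that singular_iff[OF config m k] by auto
      then have "rig \<eta> k x \<noteq> []" using length_rig[OF config, of k x] by auto
      then have "vac \<eta> k x \<le> charge \<eta> k x - int k"
        using sing rig_invariant[OF config k, of x] by simp
      then have "\<forall>l\<in>{1..k}. seat \<eta> l x = 1" using vac_le_charge_iff_full[OF config] by blast
      with s(1,2) show ?thesis by (metis atLeastAtMost_iff not_less zero_neq_one)
    qed
    have top: "singular_length x \<mu> J (s - 1)" if "1 < s"
    proof -
      have k: "1 \<le> s - 1" and seats: "seat \<eta> (s - 1) x = 1" "seat \<eta> (s - 1 + 1) x = 0"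
        using that s by auto
      have "0 < m_up \<eta> (s - 1) x" using m_up_ge[OF config k, of x] seats by simp
      moreover have "last (rig \<eta> (s - 1) x) = charge \<eta> (s - 1) x - int (s - 1)"
        using rig_invariant[OF config k, of x] seats by blast
      moreover have "vac \<eta> (s - 1) x = charge \<eta> (s - 1) x - int (s - 1)"
        using s by (intro vac_eq_charge_if_full[OF config]) auto
      ultimately show ?thesis using singular_iff[OF config m k] by simp
    qed
    define \<mu>' where "\<mu>' = grow \<mu> (s - 1)"
    \<comment> \<open>For \<open>s = 1\<close> this also alters the array at index 0, which
      \<open>kkr_step\<close> leaves alone. \<open>matches\<close> reads indices from 1 on, so the
      difference is invisible there; the case split on \<open>s = 1\<close> below accounts for
      it.\<close>
    define J' where "J' = J(s - 1 := butlast (J (s - 1)), s := insort (vacancy (x + 1) \<mu>' s) (J s))"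
    have row: "\<exists>i\<ge>1. \<mu> i = s - 1"
    proof (cases "s = 1")
      case True
      \<comment> \<open>Only finitely many rows are nonzero, so some row of length 0 is available to
        \<open>grow\<close>.\<close>
      have "{i. 1 \<le> i \<and> \<mu> i \<noteq> 0} \<noteq> {1..}" using fin infinite_Ici[of "1::nat"] by metis
      with True show ?thesis by auto
    next
      case False
      with s(1) top show ?thesis by (simp add: singular_length_def)
    qed
    have fin': "finite {i. 1 \<le> i \<and> \<mu>' i \<noteq> 0}"
      using finite_grow[OF fin row] by (simp add: \<mu>'_def)
    have conj': "int (conj_part \<mu>' k) = ups \<eta> k (Suc x)" if "1 \<le> k" for k
      using conj_part_grow[OF fin row that] s(1,5) conj that by (simp add: \<mu>'_def ups_Suc)
    have "vacancy (x + 1) \<mu>' s = vac \<eta> s (Suc x)"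
      using matches_vacancy[OF fin' conj'] by simp
    moreover have "vac \<eta> s (Suc x) = charge \<eta> s (Suc x) - int s"
      using s by (intro vac_eq_charge_if_full[OF config]) auto
    \<comment> \<open>The inserted value bounds all entries present, so \<open>insort\<close>
      appends it at the end, just as a push does.\<close>
    then have "\<forall>e\<in>set (rig \<eta> s x). e \<le> vac \<eta> s (Suc x)"
      using rig_invariant[OF config s(1), of x] charge_mono[OF config, of s x] by force
    then have "insort (vac \<eta> s (Suc x)) (rig \<eta> s x) = rig \<eta> s (Suc x)"
      using rig_invariant[OF config s(1), of x] rig_push[OF config s(1), of x] s(1) s(5)
      by (simp add: sorted_insort_is_snoc)
    ultimately have push: "J' s = rig \<eta> s (Suc x)" using J[OF s(1)] by (simp add: J'_def)
    have J': "J' k = rig \<eta> k (Suc x)" if "1 \<le> k" for k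
    proof -
      consider "k = s" | "k + 1 = s" | "k \<noteq> s" "k + 1 \<noteq> s" by blast
      then show ?thesis
      proof cases
        case 2
        with that s(5) show ?thesis
          by (auto simp: J'_def J rig_pop[OF config that])
      next
        case 3
        with that s(1,5) show ?thesis
          by (auto simp: J'_def J rig_idle[OF config])
      qed (simp add: push)
    qed
    have "kkr_step x (\<eta> (Suc x)) (\<mu>, J)
      = (\<mu>', if s = 1 then J(1 := insort (vacancy (x + 1) \<mu>' 1) (J 1)) else J')"
    proof (cases "s = 1")
      case True
      then have "\<not> (\<exists>k. singular_length x \<mu> J k)"
        using below by (force simp: singular_length_def)
      with 1 True show ?thesis by (auto simp: kkr_step_def \<mu>'_def Let_def)
    next
      case False
      have "Max {k. singular_length x \<mu> J k} = s - 1"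
      proof (rule Max_eqI)
        show "finite {k. singular_length x \<mu> J k}"
          by (rule finite_subset[of _ "{..<s}"]) (use below in auto)
      qed (use below top False s(1) in force)+
      with 1 False s(1) top show ?thesis by (auto simp: kkr_step_def \<mu>'_def J'_def Let_def)
    qed
    moreover have "(J(1 := insort (vacancy (x + 1) \<mu>' 1) (J 1))) k = J' k"
      if "s = 1" "1 \<le> k" for k
      using that by (simp add: J'_def)
    ultimately show ?thesis
      using fin' conj' J' by (simp add: matches_def)
  qed
qed

lemma matches_kkr:
  assumes "\<eta> \<in> Omega"
  shows "matches \<eta> x (kkr \<eta> x)"
proof (induction x)
  case 0
  then show ?case by (simp add: matches_def conj_part_def ups_def rig_def m_up_def)
next
  case (Suc x)
  then show ?case using matches_step[OF assms, of x "fst (kkr \<eta> x)" "snd (kkr \<eta> x)"] by simp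
qed

theorem proposition2p2:
  fixes \<eta> :: "nat \<Rightarrow> int" and k x :: nat
  assumes "\<eta> \<in> Omega" and "1 \<le> k"
  shows "int (kkr_lambda \<eta> k x) = (\<Sum>y=1..x. eta_up \<eta> k y)
    \<and> kkr_p \<eta> k x = int x - 2 * (\<Sum>l=1..k. \<Sum>y=1..x. eta_up \<eta> l y)
    \<and> (\<forall>j\<in>{1..m_up \<eta> k x}. up_times \<eta> k x j \<noteq> {})
    \<and> kkr_J \<eta> k x = map (\<lambda>j. kkr_p \<eta> k (t_up \<eta> k x j)) [1..m_up \<eta> k x]"
proof -
  \<comment> \<open>Needed for every time, since the entries of \<open>kkr_J\<close> evaluate the
    vacancy at the push times \<open>t_up\<close>.\<close>
  have p: "kkr_p \<eta> k x = vac \<eta> k x" for x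
    unfolding kkr_p_def kkr_mu_def
    using matches_kkr[OF assms(1), of x] by (intro matches_vacancy) (auto simp: matches_def)
  have "int (kkr_lambda \<eta> k x) = ups \<eta> k x" "kkr_J \<eta> k x = rig \<eta> k x"
    using matches_kkr[OF assms(1), of x] assms(2)
    by (auto simp: matches_def kkr_lambda_def kkr_mu_def kkr_J_def)
  then show ?thesis
    using p up_times_nonempty[OF assms] by (auto simp: vac_def ups_def rig_def)
qed

end
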